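(* For every integer $n\ge 1$, $$B_{2n}=\frac{2n}{2^{2n}(1-2^{2n})}\sum_{k=1}^{n}\frac{1}{k}\sum_{r=0}^{k}\frac{(-1)^r}{2^r}\binom{k}{r}\sum_{j=0}^{k-r}\frac{(-1)^j}{2^j}\binom{k-r}{j}(r-j)^{2n}.$$
   Context: The Bernoulli numbers $B_m$ are defined by $\frac{x}{e^x-1}=\sum_{m=0}^\infty B_m\frac{x^m}{m!}$ for $|x|<2\pi$. *)

theory Defs
  imports "HOL-Complex_Analysis.Complex_Analysis"
begin

text \<open>
  The function \<open>x / (e\<^sup>x - 1)\<close> with its removable singularity at \<open>0\<close> filled in
  (the bare quotient would be \<open>0\<close> there, since \<open>0 / 0 = 0\<close> in HOL).
\<close>

definition bernoulli_gf :: "real \<Rightarrow> real" where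
  "bernoulli_gf x = (if x = 0 then 1 else x / (exp x - 1))"

definition bernoulli_expansion :: "(nat \<Rightarrow> real) \<Rightarrow> bool" where
  "bernoulli_expansion B \<longleftrightarrow>
     (\<forall>x. \<bar>x\<bar> < 2 * pi \<longrightarrow> (\<lambda>m. B m * (x ^ m / fact m)) sums bernoulli_gf x)"

text \<open>The description is proper: see \<open>ex1_bernoulli_expansion\<close> below.\<close>

definition bernoulli :: "nat \<Rightarrow> real" where
  "bernoulli = (THE B. bernoulli_expansion B)"

lemma bernoulli_expansion_exists: "\<exists>B. bernoulli_expansion B"
proof -
  define h :: "complex \<Rightarrow> complex" where
    "h = (\<lambda>z. if z = 0 then deriv exp 0 else (exp z - exp 0) / (z - 0))"
  define g :: "complex \<Rightarrow> complex" where "g = (\<lambda>z. inverse (h z))"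
  define B where "B = (\<lambda>n. Re ((deriv ^^ n) g 0))"
  have d: "deriv exp (0::complex) = 1"
    by (intro DERIV_imp_deriv) (auto intro!: derivative_eq_intros)
  have hol_h: "h holomorphic_on ball 0 (2 * pi)"
    unfolding h_def by (rule pole_lemma) (auto intro: holomorphic_intros)
  have nz: "h z \<noteq> 0" if "z \<in> ball 0 (2 * pi)" for z
  proof (cases "z = 0")
    case False
    have "exp z \<noteq> 1"
    proof
      assume "exp z = 1"
      moreover have "\<bar>Im z - Im 0\<bar> < 2 * pi"
        using that abs_Im_le_cmod[of z] by simp
      ultimately have "z = 0" using exp_complex_eqI[of z 0] by simp
      with False show False by simp
    qed
    with False show ?thesis by (simp add: h_def)
  qed (simp add: h_def d)
  have hol_g: "g holomorphic_on ball 0 (2 * pi)"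
    unfolding g_def using hol_h nz by (intro holomorphic_intros) auto
  have "bernoulli_expansion B"
    unfolding bernoulli_expansion_def
  proof (intro allI impI)
    fix x :: real assume x: "\<bar>x\<bar> < 2 * pi"
    have gx: "g (of_real x) = of_real (bernoulli_gf x)"
      by (simp add: g_def h_def d bernoulli_gf_def exp_of_real)
    have "(\<lambda>n. (deriv ^^ n) g 0 / fact n * (of_real x - 0) ^ n) sums g (of_real x)"
      by (rule holomorphic_power_series[OF hol_g]) (use x in simp)
    then have "(\<lambda>n. Re ((deriv ^^ n) g 0 / fact n * (of_real x - 0) ^ n)) sums Re (g (of_real x))"
      by (rule sums_Re)
    moreover have "Re ((deriv ^^ n) g 0 / fact n * (of_real x - 0) ^ n) = B n * (x ^ n / fact n)" for n
    proof -
      have "(deriv ^^ n) g 0 / fact n * (of_real x - 0) ^ n =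
              (deriv ^^ n) g 0 * of_real (x ^ n / fact n)"
        by simp
      moreover have "Re (z * of_real t) = Re z * t" for z t
        by simp
      ultimately show ?thesis by (simp only: B_def)
    qed
    ultimately show "(\<lambda>m. B m * (x ^ m / fact m)) sums bernoulli_gf x"
      by (simp add: gx)
  qed
  then show ?thesis by blast
qed

lemma bernoulli_expansion_unique:
  assumes "bernoulli_expansion A" "bernoulli_expansion B"
  shows "A = B"
proof
  fix n
  define c where "c = (\<lambda>m. (A m - B m) / fact m)"
  have s: "(\<lambda>m. c m * (x - 0) ^ m) sums 0" if "norm (x - 0) < 2 * pi" for x :: real
  proof -
    have "(\<lambda>m. A m * (x ^ m / fact m) - B m * (x ^ m / fact m)) sums
            (bernoulli_gf x - bernoulli_gf x)"
      using assms that unfolding bernoulli_expansion_def by (intro sums_diff) auto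
    then show ?thesis by (simp add: c_def field_simps)
  qed
  have "c n = 0"
  proof (cases "n = 0")
    case True
    then show ?thesis using s[of 0] by simp
  next
    case False
    show ?thesis
    proof (rule ccontr)
      assume "c n \<noteq> 0"
      show False
      proof (rule powser_0_nonzero[of "2 * pi" 0 c "\<lambda>_. 0" n])
        fix r :: real
        assume r: "0 < r" "\<And>z. z \<in> cball 0 r - {0::real} \<Longrightarrow> (0::real) \<noteq> 0"
        from r(2)[of r] r(1) show False by simp
      qed (use s False \<open>c n \<noteq> 0\<close> in auto)
    qed
  qed
  then show "A n = B n" by (simp add: c_def)
qed

lemma ex1_bernoulli_expansion: "\<exists>!B. bernoulli_expansion B"
  using bernoulli_expansion_exists bernoulli_expansion_unique by blast

lemma bernoulli_sums:
  assumes "\<bar>x\<bar> < 2 * pi"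
  shows "(\<lambda>m. bernoulli m * (x ^ m / fact m)) sums bernoulli_gf x"
proof -
  have "bernoulli_expansion bernoulli"
    unfolding bernoulli_def by (rule theI'[OF ex1_bernoulli_expansion])
  with assms show ?thesis
    by (simp add: bernoulli_expansion_def)
qed

end

theory Submission
  imports Defs
begin

text \<open>
  Write \<open>u = 1 - cosh x\<close>.  Expanding \<open>u ^ k = (1 - exp x / 2 - exp (- x) / 2) ^ k\<close> by the
  binomial theorem shows that the double sum over \<open>r\<close> and \<open>j\<close> is \<open>(2n)!\<close> times the coefficient
  of \<open>x ^ (2n)\<close> in \<open>u ^ k\<close>.  Since \<open>u\<close> has order two, dividing by \<open>k\<close> and summing over
  \<open>k \<le> n\<close> gives, up to terms of order above \<open>2n\<close>, the logarithmic series of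
  \<open>- ln (1 - u) = - ln (cosh x)\<close>.  Its derivative is \<open>- tanh x\<close>, whose coefficients are Bernoulli
  numbers because \<open>x * tanh x = x - 2x / (exp (2x) - 1) + 4x / (exp (4x) - 1)\<close>.

  The argument is carried out with formal power series over the reals, without logarithms: the
  derivative of the truncated logarithmic series is a finite geometric sum, so
  \<open>one_diff_power_eq\<close> gives an identity with the explicit error factor \<open>1 - u ^ n\<close>
  (\<open>deriv_truncated_log\<close>).  The lemma \<open>fps_nth_one_minus_cosh_power\<close> supplies the double sum, and
  \<open>x_tanh_fps_times_cosh\<close> the Bernoulli numbers.
\<close>

section \<open>The generating function as a formal power series\<close>

text \<open>
  The difference of two expansions of \<open>f\<close> represents \<open>0\<close> near the origin, and the zeros of a
  nonzero power series are isolated.  This argument applies over the reals as well as over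
  the complex numbers.
\<close>
lemma has_fps_expansion_unique:
  fixes f :: "'a :: {banach, real_normed_field} \<Rightarrow> 'a"
  assumes "f has_fps_expansion F" "f has_fps_expansion G"
  shows "F = G"
proof -
  define H where "H = F - G"
  have "(\<lambda>x. f x - f x) has_fps_expansion H"
    unfolding H_def by (intro has_fps_expansion_diff assms)
  then have radius: "fps_conv_radius H > 0" and ev: "eventually (\<lambda>x. eval_fps H x = 0) (nhds 0)"
    by (auto simp: has_fps_expansion_def)
  have "eventually (\<lambda>x. x \<in> eball 0 (fps_conv_radius H)) (nhds (0::'a))"
    using radius
    by (intro eventually_nhds_in_open) (auto simp: zero_ereal_def)
  with ev have "eventually (\<lambda>x. (\<lambda>n. H $ n * x ^ n) sums 0) (nhds 0)"
  proof eventually_elim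
    case (elim x)
    then show "(\<lambda>n. H $ n * x ^ n) sums 0"
      using sums_eval_fps[of x H] by simp
  qed
  then obtain r where r: "r > 0" "\<And>x. norm x < r \<Longrightarrow> (\<lambda>n. H $ n * x ^ n) sums 0"
    by (auto simp: eventually_nhds_metric)
  have "H $ n = 0" for n
  proof (cases "n = 0")
    case True
    then show ?thesis using r(2)[of 0] r(1) by simp
  next
    case False
    show ?thesis
    proof (rule ccontr)
      assume nz: "H $ n \<noteq> 0"
      show False
      proof (rule powser_0_nonzero[of r 0 "fps_nth H" "\<lambda>_. 0" n])
        fix s :: real
        assume s: "0 < s" "\<And>z. z \<in> cball 0 s - {0::'a} \<Longrightarrow> (0::'a) \<noteq> 0"
        from s(2)[of "of_real s"] s(1) show False by simp
      qed (use r nz False in auto)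
    qed
  qed
  then have "H = 0" by (intro fps_ext) simp
  then show "F = G" by (simp add: H_def)
qed

definition bernoulli_fps :: "real fps" where
  "bernoulli_fps = Abs_fps (\<lambda>m. bernoulli m / fact m)"

lemma bernoulli_fps_times_exp_minus_one:
  "bernoulli_fps * (fps_exp 1 - 1) = fps_X"
proof (rule has_fps_expansion_unique)
  have "eventually (\<lambda>x::real. x \<in> ball 0 (2 * pi)) (nhds 0)"
    by (intro eventually_nhds_in_open) auto
  then have "bernoulli_gf has_fps_expansion bernoulli_fps"
    by (intro has_fps_expansionI)
       (auto elim!: eventually_mono dest!: bernoulli_sums simp: bernoulli_fps_def)
  then show "(\<lambda>x. bernoulli_gf x * (exp x - 1)) has_fps_expansion
      bernoulli_fps * (fps_exp 1 - 1)"
    by (intro has_fps_expansion_mult has_fps_expansion_diff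
        has_fps_expansion_exp1 has_fps_expansion_1)
  have "(\<lambda>x::real. bernoulli_gf x * (exp x - 1)) = (\<lambda>x. x)"
    by (auto simp: bernoulli_gf_def)
  then show "(\<lambda>x. bernoulli_gf x * (exp x - 1)) has_fps_expansion fps_X"
    by (simp add: has_fps_expansion_fps_X)
qed

definition scaled_bernoulli_fps :: "real \<Rightarrow> real fps" where
  "scaled_bernoulli_fps c = Abs_fps (\<lambda>m. c ^ m * (bernoulli m / fact m))"

lemma scaled_bernoulli_fps_times_exp_minus_one:
  "scaled_bernoulli_fps c * (fps_exp c - 1) = fps_const c * fps_X"
proof -
  let ?l = "fps_const c * fps_X"
  have "(bernoulli_fps * (fps_exp 1 - 1)) oo ?l = (bernoulli_fps oo ?l) * ((fps_exp 1 - 1) oo ?l)"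
    by (rule fps_compose_mult_distrib) simp
  moreover have "bernoulli_fps oo ?l = scaled_bernoulli_fps c"
    by (simp add: fps_compose_linear bernoulli_fps_def scaled_bernoulli_fps_def)
  moreover have "(fps_exp 1 - 1) oo ?l = fps_exp c - 1"
    by (simp add: fps_compose_sub_distrib)
  ultimately show ?thesis
    by (simp add: bernoulli_fps_times_exp_minus_one fps_X_fps_compose_startby0)
qed

section \<open>Hyperbolic functions\<close>

definition cosh_fps :: "real fps" where
  "cosh_fps = fps_const (1/2) * (fps_exp 1 + fps_exp (- 1))"

definition sinh_fps :: "real fps" where
  "sinh_fps = fps_const (1/2) * (fps_exp 1 - fps_exp (- 1))"

lemma deriv_cosh_fps: "fps_deriv cosh_fps = sinh_fps"
  by (simp add: cosh_fps_def sinh_fps_def flip: fps_const_neg)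

lemma cosh_fps_nonzero: "cosh_fps \<noteq> 0"
proof
  assume "cosh_fps = 0"
  then have "cosh_fps $ 0 = 0" by simp
  then show False by (simp add: cosh_fps_def)
qed

definition x_tanh_fps :: "real fps" where
  "x_tanh_fps = fps_X - scaled_bernoulli_fps 2 + scaled_bernoulli_fps 4"

text \<open>
  With \<open>E = exp (2x)\<close> and \<open>exp (4x) - 1 = (E - 1) * (E + 1)\<close>, clearing denominators in
  \<open>x - 2x / (E - 1) + 4x / (E\<^sup>2 - 1)\<close> leaves \<open>x * (E - 1)\<^sup>2\<close>, so the left side equals
  \<open>x * (E - 1) / (E + 1)\<close>.
\<close>
lemma x_tanh_fps_times_cosh: "x_tanh_fps * cosh_fps = fps_X * sinh_fps"
proof -
  define E :: "real fps" where "E = fps_exp 2"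
  define G2 where "G2 = scaled_bernoulli_fps 2"
  define G4 where "G4 = scaled_bernoulli_fps 4"
  have E2: "fps_exp 4 = E * E"
    unfolding E_def by (simp flip: fps_exp_add_mult)
  have G2: "G2 * (E - 1) = 2 * fps_X"
    using scaled_bernoulli_fps_times_exp_minus_one[of 2]
    by (simp add: G2_def E_def numeral_fps_const)
  have G4: "G4 * (E * E - 1) = 4 * fps_X"
    using scaled_bernoulli_fps_times_exp_minus_one[of 4]
    by (simp add: G4_def E2 numeral_fps_const)
  have "(E - 1) * ((fps_X - G2 + G4) * (E + 1)) =
      fps_X * (E * E - 1) - (G2 * (E - 1)) * (E + 1) + G4 * (E * E - 1)"
    by (simp add: algebra_simps)
  also have "\<dots> = (E - 1) * (fps_X * (E - 1))"
    unfolding G2 G4 by (simp add: algebra_simps)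
  finally have "(E - 1) * (x_tanh_fps * (E + 1)) = (E - 1) * (fps_X * (E - 1))"
    by (simp add: x_tanh_fps_def G2_def G4_def)
  moreover have "E - 1 \<noteq> 0"
    by (simp add: E_def)
  ultimately have *: "x_tanh_fps * (E + 1) = fps_X * (E - 1)"
    by (simp only: mult_cancel_left) simp
  define F :: "real fps" where "F = fps_const (1/2) * fps_exp (- 1)"
  have "fps_exp (- 1) * E = fps_exp 1"
    by (simp add: E_def flip: fps_exp_add_mult)
  then have "cosh_fps = F * (E + 1)" "sinh_fps = F * (E - 1)"
    by (simp_all add: cosh_fps_def sinh_fps_def F_def distrib_left right_diff_distrib mult.assoc)
  then show ?thesis
    using * by (metis mult.left_commute)
qed

lemma x_tanh_fps_nth_0: "x_tanh_fps $ 0 = 0"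
  by (simp add: x_tanh_fps_def scaled_bernoulli_fps_def)

lemma x_tanh_fps_nth_even:
  assumes "n \<ge> 1"
  shows "x_tanh_fps $ (2 * n) = 2 ^ (2 * n) * (2 ^ (2 * n) - 1) * bernoulli (2 * n) / fact (2 * n)"
proof -
  have "(4::real) ^ (2 * n) = 2 ^ (2 * n) * 2 ^ (2 * n)"
    by (simp flip: power_mult_distrib)
  then show ?thesis
    using assms by (simp add: x_tanh_fps_def scaled_bernoulli_fps_def fps_X_def field_simps)
qed

section \<open>Powers of \<open>1 - cosh x\<close>\<close>

definition one_minus_cosh_fps :: "real fps" where
  "one_minus_cosh_fps = 1 - cosh_fps"

lemma one_minus_cosh_fps_power_nth_eq_0:
  assumes "m < 2 * k"
  shows "(one_minus_cosh_fps ^ k) $ m = 0"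
proof (cases "one_minus_cosh_fps = 0")
  case True
  then show ?thesis using assms by (cases k) auto
next
  case False
  have "one_minus_cosh_fps $ i = 0" if "i < 2" for i
    using that by (auto simp: less_2_cases_iff one_minus_cosh_fps_def cosh_fps_def)
  with False have "2 \<le> subdegree one_minus_cosh_fps"
    by (intro subdegree_geI) auto
  then have "2 * k \<le> k * subdegree one_minus_cosh_fps"
    by (simp add: mult.commute)
  then show ?thesis
    using assms by (intro fps_pow_nth_below_subdegree) linarith
qed

text \<open>
  Splitting \<open>1 - cosh x\<close> as \<open>(- exp x / 2) + (1 - exp (- x) / 2)\<close>, one application of the
  binomial theorem produces the sum over \<open>r\<close> and a second one the sum over \<open>j\<close>.  The
  product of exponentials is then \<open>exp ((r - j) * x)\<close>.
\<close>
lemma fps_nth_one_minus_cosh_power: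
  "(one_minus_cosh_fps ^ k) $ m =
     (\<Sum>r=0..k. (- 1) ^ r / 2 ^ r * real (k choose r) *
       (\<Sum>j=0..k - r. (- 1) ^ j / 2 ^ j * real ((k - r) choose j) *
         (real r - real j) ^ m)) / fact m"
proof -
  define A B :: "real fps"
    where "A = fps_const (- 1 / 2) * fps_exp 1" and "B = fps_const (- 1 / 2) * fps_exp (- 1)"
  have u: "one_minus_cosh_fps = A + (B + 1)"
  proof (rule fps_ext)
    fix i show "one_minus_cosh_fps $ i = (A + (B + 1)) $ i"
      by (simp add: one_minus_cosh_fps_def cosh_fps_def A_def B_def algebra_simps)
  qed
  have pow: "(- 1 / 2 :: real) ^ i = (- 1) ^ i / 2 ^ i" for i
    by (rule power_divide)
  have A: "A ^ r = fps_const ((- 1) ^ r / 2 ^ r) * fps_exp (real r)" for r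
    unfolding A_def power_mult_distrib fps_const_power pow fps_exp_power_mult by simp
  have B: "B ^ j = fps_const ((- 1) ^ j / 2 ^ j) * fps_exp (- real j)" for j
    unfolding B_def power_mult_distrib fps_const_power pow fps_exp_power_mult by simp
  have AB: "A ^ r * B ^ j =
      fps_const ((- 1) ^ r / 2 ^ r * ((- 1) ^ j / 2 ^ j)) * fps_exp (real r - real j)" for r j
  proof -
    have "fps_exp (real r - real j) = fps_exp (real r) * fps_exp (- real j)"
      by (simp flip: fps_exp_add_mult)
    then show ?thesis
      unfolding A B by (simp only: fps_const_mult[symmetric] mult_ac)
  qed
  have "one_minus_cosh_fps ^ k =
      (\<Sum>r=0..k. \<Sum>j=0..k - r. of_nat (k choose r) * (of_nat ((k - r) choose j) * (A ^ r * B ^ j)))"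
    unfolding u binomial_ring atMost_atLeast0
    by (intro sum.cong refl) (simp add: sum_distrib_left mult_ac)
  also have "\<dots> = (\<Sum>r=0..k. \<Sum>j=0..k - r.
      fps_const (real (k choose r) * (real ((k - r) choose j) *
        ((- 1) ^ r / 2 ^ r * ((- 1) ^ j / 2 ^ j)))) * fps_exp (real r - real j))"
    unfolding AB by (simp only: fps_of_nat[symmetric] fps_const_mult[symmetric] mult.assoc)
  finally show ?thesis
    by (simp add: fps_sum_nth sum_divide_distrib sum_distrib_left mult_ac)
qed

section \<open>The truncated logarithm\<close>

definition truncated_log_fps :: "nat \<Rightarrow> real fps" where
  "truncated_log_fps n = (\<Sum>k=1..n. fps_const (1 / real k) * one_minus_cosh_fps ^ k)"

text \<open>
  A truncated form of \<open>x * (- ln (cosh x))' = - x * tanh x\<close>, obtained by summing the geometric series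
  \<open>\<Sum>k<n. u ^ k\<close> with \<open>1 - u = cosh x\<close>.
\<close>
lemma deriv_truncated_log:
  "fps_X * fps_deriv (truncated_log_fps n) = - x_tanh_fps * (1 - one_minus_cosh_fps ^ n)"
proof -
  let ?u = one_minus_cosh_fps
  have u': "fps_deriv ?u = - sinh_fps"
    by (simp add: one_minus_cosh_fps_def deriv_cosh_fps)
  have "fps_deriv (truncated_log_fps n) =
      (\<Sum>k=1..n. fps_const (1 / real k) * (fps_const (real k) * (fps_deriv ?u * ?u ^ (k - 1))))"
    by (simp add: truncated_log_fps_def fps_deriv_sum fps_deriv_power mult.assoc)
  also have "\<dots> = (\<Sum>k=1..n. - sinh_fps * ?u ^ (k - 1))"
    unfolding u' mult.assoc[symmetric] fps_const_mult by (intro sum.cong) auto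
  also have "\<dots> = - sinh_fps * (\<Sum>i<n. ?u ^ i)"
    unfolding sum_distrib_left[symmetric]
    by (simp add: sum.atLeast1_atMost_eq)
  finally have "cosh_fps * (fps_X * fps_deriv (truncated_log_fps n)) =
      - (fps_X * sinh_fps) * (cosh_fps * (\<Sum>i<n. ?u ^ i))"
    by (simp add: mult_ac)
  also have "cosh_fps * (\<Sum>i<n. ?u ^ i) = 1 - ?u ^ n"
    by (subst one_diff_power_eq) (simp add: one_minus_cosh_fps_def)
  also have "- (fps_X * sinh_fps) * (1 - ?u ^ n) = cosh_fps * (- x_tanh_fps * (1 - ?u ^ n))"
    unfolding x_tanh_fps_times_cosh[symmetric] by (simp add: mult_ac)
  finally show ?thesis
    using cosh_fps_nonzero by (simp only: mult_cancel_left) simp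
qed

lemma truncated_log_nth:
  assumes "n \<ge> 1"
  shows "2 * real n * truncated_log_fps n $ (2 * n) = - (x_tanh_fps $ (2 * n))"
proof -
  have error: "(x_tanh_fps * one_minus_cosh_fps ^ n) $ (2 * n) = 0"
    unfolding fps_mult_nth
  proof (rule sum.neutral, rule ballI)
    fix i assume "i \<in> {0..2 * n}"
    (* The factor u ^ n only guarantees vanishing below degree 2n; the zero constant term of
       x * tanh x covers the remaining index. *)
    then show "x_tanh_fps $ i * (one_minus_cosh_fps ^ n) $ (2 * n - i) = 0"
      using assms
      by (cases "i = 0") (auto simp: x_tanh_fps_nth_0 one_minus_cosh_fps_power_nth_eq_0)
  qed
  have "(fps_X * fps_deriv (truncated_log_fps n)) $ (2 * n) =
      2 * real n * truncated_log_fps n $ (2 * n)"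
    using assms by (simp add: of_nat_diff)
  moreover have "(fps_X * fps_deriv (truncated_log_fps n)) $ (2 * n) = - (x_tanh_fps $ (2 * n))"
    unfolding deriv_truncated_log using error by (simp add: right_diff_distrib)
  ultimately show ?thesis by simp
qed

section \<open>The formula for the Bernoulli numbers\<close>

theorem mainTheorem7:
  fixes n :: nat
  assumes "n \<ge> 1"
  shows "bernoulli (2 * n) =
    (2 * real n) / (2 ^ (2 * n) * (1 - 2 ^ (2 * n))) *
    (\<Sum>k=1..n. 1 / real k *
      (\<Sum>r=0..k. (- 1) ^ r / 2 ^ r * real (k choose r) *
        (\<Sum>j=0..k - r. (- 1) ^ j / 2 ^ j * real ((k - r) choose j) *
          (real r - real j) ^ (2 * n))))"
    (is "_ = _ * ?S")
proof -
  define p :: real where "p = 2 ^ (2 * n)"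
  have "p > 1"
    unfolding p_def using assms by (intro one_less_power) auto
  have "truncated_log_fps n $ (2 * n) = ?S / fact (2 * n)"
    unfolding truncated_log_fps_def fps_sum_nth fps_mult_left_const_nth
      fps_nth_one_minus_cosh_power
    by (subst sum_divide_distrib) (intro sum.cong refl times_divide_eq_right)
  then have "2 * real n * (?S / fact (2 * n)) = - (p * (p - 1) * bernoulli (2 * n) / fact (2 * n))"
    using truncated_log_nth[OF assms] x_tanh_fps_nth_even[OF assms] by (simp only: p_def)
  then have "2 * real n * ?S = p * (1 - p) * bernoulli (2 * n)"
    by (simp add: field_simps)
  moreover have "p * (1 - p) \<noteq> 0"
    using \<open>p > 1\<close> by simp
  ultimately have "bernoulli (2 * n) = 2 * real n / (p * (1 - p)) * ?S"
    by (simp add: nonzero_eq_divide_eq mult.commute)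
  then show ?thesis
    by (simp only: p_def)
qed

end
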